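(* Let $\mathbf{U}$ be a finite set of players. The MPW solution $\mathrm{MPW}$ is the unique solution $\varphi$ for TUX games (with player sets $N\subseteq\mathbf{U}$) that satisfies the following three properties. (Efficiency, EF$^{X}$) For all $N\subseteq\mathbf{U}$ and $w\in\mathbb{W}(N)$: $\sum_{i\in N}\varphi_i(w)=w(N,\emptyset)$. (2-Standardness, 2S$^{X}$) For all $\{i,j\}\subseteq\mathbf{U}$ with $i\neq j$ and all $w\in\mathbb{W}(\{i,j\})$: $$\varphi_i(w)=w(\{i\},\{\{j\}\})+\frac{w(\{i,j\},\emptyset)-w(\{j\},\{\{i\}\})-w(\{i\},\{\{j\}\})}{2}.$$ (Sobolev consistency, SC$^{X}$) For all $N\subseteq\mathbf{U}$, $w\in\mathbb{W}(N)$, and $i,j\in N$ with $i\neq j$: $\varphi_i(w)=\varphi_i\big(w_{-j}^{So,\varphi}\big)$, where $w_{-j}^{So,\varphi}\in\mathbb{W}(N\setminus\{j\})$ is the Sobolev reduced game $$w_{-j}^{So,\varphi}(S,\pi)=\frac{s}{n-1}\big(w(S\cup\{j\},\pi)-\varphi_j(w)\big)+\Big(1-\frac{s}{n-1}\Big)w_{-j}(S,\pi)\quad\text{for all }(S,\pi)\in\mathcal{E}(N\setminus\{j\}).$$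
   Context: Let $\mathbf{U}$ be a finite set (the universe of players). Cardinalities of sets $N,S,T,B\subseteq\mathbf{U}$ are denoted $n,s,t,b$. Partitions. For $N\subseteq\mathbf{U}$, $\Pi(N)$ is the set of partitions of $N$ into non-empty blocks, with $\Pi(\emptyset)=\{\emptyset\}$. For $\pi\in\Pi(N)$ and $i\in N$, $\pi(i)$ is the block containing $i$. For $\pi\in\Pi(N)$, $i\in\mathbf{U}\setminus N$, $B\in\pi$: $\pi_{+i\rightsquigarrow B}=(\pi\setminus\{B\})\cup\{B\cup\{i\}\}$ and $\pi_{+i\rightsquigarrow\emptyset}=\pi\cup\{\{i\}\}$. TUX games. $\mathcal{E}(N)=\{(S,\pi)\mid S\subseteq N,\ \pi\in\Pi(N\setminus S)\}$ is the set of embedded coalitions. A TUX game (game with externalities) for $N\subseteq\mathbf{U}$ is a function $w:\mathcal{E}(N)\to\mathbb{R}$ with $w(\emptyset,\pi)=0$ for all $\pi\in\Pi(N)$; $\mathbb{W}(N)$ is the set of these. A solution for TUX games is a map $\varphi$ assigning to each $w\in\mathbb{W}(N)$, $N\subseteq\mathbf{U}$, a vector $\varphi(w)\in\mathbb{R}^N$. Removal of a player. For $w\in\mathbb{W}(N)$ and $i\in N$, the game $w_{-i}\in\mathbb{W}(N\setminus\{i\})$ is defined by $$w_{-i}(S,\pi)=\frac{1}{n-s}\Big(w(S,\pi_{+i\rightsquigarrow\emptyset})+\sum_{j\in N\setminus(S\cup\{i\})}w(S,\pi_{+i\rightsquigarrow\pi(j)})\Big)\quad\text{for all }(S,\pi)\in\mathcal{E}(N\setminus\{i\}).$$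 MPW solution. A TU game for $N$ is a function $v:2^N\to\mathbb{R}$ with $v(\emptyset)=0$; its Shapley value is $\mathrm{Sh}_i(v)=\sum_{S\subseteq N\setminus\{i\}}\frac{s!(n-s-1)!}{n!}\left(v(S\cup\{i\})-v(S)\right)$, $i\in N$. For $w\in\mathbb{W}(N)$, the average game $\bar v_w$ is the TU game for $N$ given by $$\bar v_w(S)=\sum_{\pi\in\Pi(N\setminus S)}\frac{\prod_{B\in\pi}(b-1)!}{(n-s)!}\,w(S,\pi)\quad\text{for all }S\subseteq N,$$ and $\mathrm{MPW}(w)=\mathrm{Sh}(\bar v_w)\in\mathbb{R}^N$. *)

theory Defs
  imports Complex_Main "HOL-Library.Disjoint_Sets" "HOL-Library.FuncSet"
begin

(* Functions with a set-theoretic domain are encoded as extensional functions, so that two games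
   (or solutions) are equal iff they agree on that domain. *)

definition partitions :: "'a set \<Rightarrow> 'a set set set"
  where "partitions N = {\<pi>. partition_on N \<pi>}"

definition block_of :: "'a set set \<Rightarrow> 'a \<Rightarrow> 'a set"
  where "block_of \<pi> i = (THE B. B \<in> \<pi> \<and> i \<in> B)"

definition add_player :: "'a set set \<Rightarrow> 'a \<Rightarrow> 'a set \<Rightarrow> 'a set set"
  where "add_player \<pi> i B = (if B = {} then \<pi> \<union> {{i}} else (\<pi> - {B}) \<union> {B \<union> {i}})"

type_synonym 'a tux = "'a set \<times> 'a set set \<Rightarrow> real"

definition embedded_coalitions :: "'a set \<Rightarrow> ('a set \<times> 'a set set) set"
  where "embedded_coalitions N = (SIGMA S:Pow N. partitions (N - S))"

definition tux_games :: "'a set \<Rightarrow> 'a tux set"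
  where "tux_games N =
    {w \<in> extensional (embedded_coalitions N). \<forall>\<pi>\<in>partitions N. w ({}, \<pi>) = 0}"

(* The player set is a separate argument because an element of 'a tux does not determine it. *)
type_synonym 'a tux_solution = "'a set \<Rightarrow> 'a tux \<Rightarrow> 'a \<Rightarrow> real"

definition tux_solutions :: "'a set \<Rightarrow> 'a tux_solution set"
  where "tux_solutions U = (\<Pi>\<^sub>E N\<in>Pow U. \<Pi>\<^sub>E w\<in>tux_games N. extensional N)"

definition remove_player :: "'a set \<Rightarrow> 'a tux \<Rightarrow> 'a \<Rightarrow> 'a tux"
  where "remove_player N w i = (\<lambda>(S, \<pi>)\<in>embedded_coalitions (N - {i}).
    1 / (real (card N) - real (card S)) *
      (w (S, add_player \<pi> i {}) +
       (\<Sum>j\<in>N - (S \<union> {i}). w (S, add_player \<pi> i (block_of \<pi> j)))))"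

definition tu_games :: "'a set \<Rightarrow> ('a set \<Rightarrow> real) set"
  where "tu_games N = {v \<in> extensional (Pow N). v {} = 0}"

definition shapley :: "'a set \<Rightarrow> ('a set \<Rightarrow> real) \<Rightarrow> 'a \<Rightarrow> real"
  where "shapley N v = (\<lambda>i\<in>N. \<Sum>S\<in>Pow (N - {i}).
    fact (card S) * fact (card N - card S - 1) / fact (card N) * (v (S \<union> {i}) - v S))"

definition average_game :: "'a set \<Rightarrow> 'a tux \<Rightarrow> 'a set \<Rightarrow> real"
  where "average_game N w = (\<lambda>S\<in>Pow N. \<Sum>\<pi>\<in>partitions (N - S).
    (\<Prod>B\<in>\<pi>. fact (card B - 1)) / fact (card N - card S) * w (S, \<pi>))"

definition MPW :: "'a set \<Rightarrow> 'a tux_solution"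
  where "MPW U = (\<lambda>N\<in>Pow U. \<lambda>w\<in>tux_games N. shapley N (average_game N w))"

definition sobolev_reduced :: "'a tux_solution \<Rightarrow> 'a set \<Rightarrow> 'a tux \<Rightarrow> 'a \<Rightarrow> 'a tux"
  where "sobolev_reduced \<phi> N w j = (\<lambda>(S, \<pi>)\<in>embedded_coalitions (N - {j}).
    real (card S) / (real (card N) - 1) * (w (S \<union> {j}, \<pi>) - \<phi> N w j) +
    (1 - real (card S) / (real (card N) - 1)) * remove_player N w j (S, \<pi>))"

definition efficient :: "'a set \<Rightarrow> 'a tux_solution \<Rightarrow> bool"
  where "efficient U \<phi> \<longleftrightarrow>
    (\<forall>N\<subseteq>U. \<forall>w\<in>tux_games N. (\<Sum>i\<in>N. \<phi> N w i) = w (N, {}))"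

definition two_standard :: "'a set \<Rightarrow> 'a tux_solution \<Rightarrow> bool"
  where "two_standard U \<phi> \<longleftrightarrow>
    (\<forall>i j. {i, j} \<subseteq> U \<and> i \<noteq> j \<longrightarrow> (\<forall>w\<in>tux_games {i, j}.
      \<phi> {i, j} w i =
        w ({i}, {{j}}) + (w ({i, j}, {}) - w ({j}, {{i}}) - w ({i}, {{j}})) / 2))"

definition sobolev_consistent :: "'a set \<Rightarrow> 'a tux_solution \<Rightarrow> bool"
  where "sobolev_consistent U \<phi> \<longleftrightarrow>
    (\<forall>N\<subseteq>U. \<forall>w\<in>tux_games N. \<forall>i\<in>N. \<forall>j\<in>N. i \<noteq> j \<longrightarrow>
      \<phi> N w i = \<phi> (N - {j}) (sobolev_reduced \<phi> N w j) i)"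

lemma partitions_empty: "partitions {} = {{}}"
  by (auto simp: partitions_def partition_on_empty)

lemma block_of_eq:
  assumes "\<pi> \<in> partitions N" "B \<in> \<pi>" "i \<in> B"
  shows "block_of \<pi> i = B"
  unfolding block_of_def using assms
  by (intro the_equality) (auto simp: partitions_def partition_on_def disjoint_def)

lemma add_player_partition:
  assumes "\<pi> \<in> partitions N" "i \<notin> N" "B \<in> insert {} \<pi>"
  shows "add_player \<pi> i B \<in> partitions (insert i N)"
proof -
  have "i \<notin> C" "C \<noteq> {}" if "C \<in> \<pi>" for C
    using that assms by (auto simp: partitions_def partition_on_def)
  moreover have "C \<inter> D = {}" if "C \<in> \<pi>" "D \<in> \<pi>" "C \<noteq> D" for C D
    using that assms by (auto simp: partitions_def partition_on_def disjoint_def)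
  moreover have "\<Union>\<pi> = N"
    using assms by (auto simp: partitions_def partition_on_def)
  ultimately show ?thesis
    using assms(3)
    by (auto simp: add_player_def partitions_def partition_on_def disjoint_def) blast+
qed

lemma block_of_in:
  assumes "\<pi> \<in> partitions N" "i \<in> N"
  shows "block_of \<pi> i \<in> \<pi>"
proof -
  from assms obtain B where "B \<in> \<pi>" "i \<in> B"
    by (auto simp: partitions_def partition_on_def)
  with block_of_eq[OF assms(1)] show ?thesis by metis
qed

lemma remove_player_tux_games:
  assumes "w \<in> tux_games N" "i \<in> N"
  shows "remove_player N w i \<in> tux_games (N - {i})"
proof -
  have N: "insert i (N - {i}) = N"
    using assms(2) by blast
  have "remove_player N w i ({}, \<pi>) = 0" if \<pi>: "\<pi> \<in> partitions (N - {i})" for \<pi>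
  proof -
    have "add_player \<pi> i B \<in> partitions N" if "B \<in> insert {} \<pi>" for B
      using add_player_partition[OF \<pi> _ that, of i] N by simp
    then have z: "w ({}, add_player \<pi> i B) = 0" if "B \<in> insert {} \<pi>" for B
      using that assms(1) by (auto simp: tux_games_def)
    have "w ({}, add_player \<pi> i (block_of \<pi> j)) = 0" if "j \<in> N - {i}" for j
      using z block_of_in[OF \<pi> that] by blast
    with z[of "{}"] \<pi> show ?thesis
      by (simp add: remove_player_def embedded_coalitions_def)
  qed
  then show ?thesis
    by (auto simp: tux_games_def remove_player_def)
qed

lemma sobolev_reduced_tux_games:
  assumes "w \<in> tux_games N" "j \<in> N"
  shows "sobolev_reduced \<phi> N w j \<in> tux_games (N - {j})"
  using remove_player_tux_games[OF assms]
  by (auto simp: tux_games_def sobolev_reduced_def embedded_coalitions_def)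

lemma average_game_tu_games:
  assumes "w \<in> tux_games N"
  shows "average_game N w \<in> tu_games N"
  using assms by (simp add: tu_games_def tux_games_def average_game_def)

lemma MPW_tux_solutions: "MPW U \<in> tux_solutions U"
  by (auto simp: MPW_def tux_solutions_def shapley_def)

end

theory Submission imports Defs begin

text \<open>The weights \<open>\<Prod>(b - 1)!\<close> are those of a random partition grown one player at a time, so that
  averaging commutes with the removal of a player. Hence the average game of the Sobolev reduced
  game is the Sobolev reduced game of the average game, and consistency is reduced to TU games. If
  the player leaving a game is paid \<open>x\<close> instead of its Shapley value, every other player gains
  \<open>1 / (n - 1)\<close> of the difference. For a consistent \<open>\<phi>\<close> that agrees with MPW on \<open>n - 1\<close> players,
  the deviation \<open>d\<close> from MPW therefore satisfies \<open>d i = - d j / (n - 1)\<close> for all \<open>i \<noteq> j\<close>, which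
  forces \<open>d = 0\<close> when \<open>n \<ge> 3\<close>.\<close>

section \<open>The Shapley value\<close>

lemma sum_Pow_insert:
  assumes "finite A" "a \<notin> A"
  shows "(\<Sum>S\<in>Pow (insert a A). f S) = (\<Sum>S\<in>Pow A. f S + f (insert a S))"
proof -
  have "inj_on (insert a) (Pow A)"
    using assms(2) by (auto simp: inj_on_def)
  moreover have "Pow A \<inter> insert a ` Pow A = {}"
    using assms(2) by auto
  ultimately show ?thesis
    using assms(1) by (simp add: Pow_insert sum.union_disjoint sum.reindex sum.distrib)
qed

text \<open>Allows the average game, which is restricted to \<open>Pow N\<close>, to be replaced by
  an unrestricted formula that agrees with it there.\<close>

lemma shapley_cong:
  assumes "\<And>S. S \<subseteq> N \<Longrightarrow> v S = v' S"
  shows "shapley N v = shapley N v'"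
  unfolding shapley_def
proof (intro restrict_ext sum.cong refl)
  fix i S assume "i \<in> N" "S \<in> Pow (N - {i})"
  then have "S \<union> {i} \<subseteq> N" "S \<subseteq> N" by auto
  then show "fact (card S) * fact (card N - card S - 1) / fact (card N) * (v (S \<union> {i}) - v S) =
    fact (card S) * fact (card N - card S - 1) / fact (card N) * (v' (S \<union> {i}) - v' S)"
    by (simp only: assms)
qed

text \<open>Double counting: collecting the terms of each coalition \<open>T\<close> of size
  \<open>t\<close> gives it the coefficient \<open>t * c (t - 1) - (n - t) * c t\<close>. Both
  products equal \<open>t! (n - t)! / n!\<close>, except that the first vanishes at
  \<open>T = {}\<close> and the second at \<open>T = N\<close>, so only these two coalitions
  survive.\<close>

lemma shapley_efficient:
  assumes "finite N" "v {} = 0"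
  shows "(\<Sum>i\<in>N. shapley N v i) = v N"
proof -
  define n where "n = card N"
  define c :: "nat \<Rightarrow> real" where "c s = fact s * fact (n - s - 1) / fact n" for s
  have joining: "(\<Sum>S\<in>Pow (N - {i}). c (card S) * v (S \<union> {i})) =
      (\<Sum>T | T \<in> Pow N \<and> i \<in> T. c (card T - 1) * v T)" if "i \<in> N" for i
  proof (rule sum.reindex_bij_witness[of _ "\<lambda>T. T - {i}" "\<lambda>S. insert i S"])
    fix S assume S: "S \<in> Pow (N - {i})"
    then have "finite S" "i \<notin> S" using assms(1) finite_subset[of S N] by auto
    then show "c (card (insert i S) - 1) * v (insert i S) = c (card S) * v (S \<union> {i})" by simp
  qed (use that in auto)
  have leaving: "(\<Sum>S\<in>Pow (N - {i}). c (card S) * v S) =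
      (\<Sum>T | T \<in> Pow N \<and> i \<notin> T. c (card T) * v T)" for i
    by (intro sum.cong) auto
  \<comment> \<open>The truncated subtractions, in \<open>card T - 1\<close> at the empty coalition
    and in \<open>c (card T)\<close> at \<open>N\<close>, are harmless because the factor in front
    is zero there.\<close>
  have coeff: "real (card T) * c (card T - 1) - real (card (N - T)) * c (card T) =
      (if T = N then 1 else 0) - (if T = {} then 1 else 0)" if T: "T \<subseteq> N" "N \<noteq> {}" for T
  proof -
    define t where "t = card T"
    have fin: "finite T" using T assms(1) finite_subset by blast
    have t: "t \<le> n" "card (N - T) = n - t" "T = N \<longleftrightarrow> t = n" "T = {} \<longleftrightarrow> t = 0" "n > 0"
      using T assms(1) fin card_subset_eq[OF assms(1) T(1)]
      by (auto simp: n_def t_def card_mono card_Diff_subset card_gt_0_iff)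
    have "real t * c (t - 1) = (if t = 0 then 0 else fact t * fact (n - t) / fact n)"
      using t(1) by (cases t) (auto simp: c_def)
    moreover have "real (n - t) * c t = (if t = n then 0 else fact t * fact (n - t) / fact n)"
    proof (cases "n - t")
      case (Suc k)
      then have "t \<noteq> n" by simp
      with Suc show ?thesis by (simp add: c_def)
    qed (use t(1) in auto)
    ultimately show ?thesis
      using t by (auto simp: t_def[symmetric] simp del: of_nat_diff)
  qed
  show ?thesis
  proof (cases "N = {}")
    case False
    have "(\<Sum>i\<in>N. shapley N v i) =
        (\<Sum>i\<in>N. (\<Sum>S\<in>Pow (N - {i}). c (card S) * v (S \<union> {i})) -
          (\<Sum>S\<in>Pow (N - {i}). c (card S) * v S))"
      by (simp add: shapley_def c_def n_def right_diff_distrib sum_subtractf)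
    also have "\<dots> = (\<Sum>i\<in>N. \<Sum>T | T \<in> Pow N \<and> i \<in> T. c (card T - 1) * v T) -
        (\<Sum>i\<in>N. \<Sum>T | T \<in> Pow N \<and> i \<notin> T. c (card T) * v T)"
      unfolding sum_subtractf
      by (intro arg_cong2[where f = minus] sum.cong refl joining leaving)
    also have "\<dots> = (\<Sum>T\<in>Pow N. \<Sum>i | i \<in> N \<and> i \<in> T. c (card T - 1) * v T) -
        (\<Sum>T\<in>Pow N. \<Sum>i | i \<in> N \<and> i \<notin> T. c (card T) * v T)"
      using assms(1) by (intro arg_cong2[where f = minus] sum.swap_restrict) auto
    also have "\<dots> = (\<Sum>T\<in>Pow N.
        (real (card T) * c (card T - 1) - real (card (N - T)) * c (card T)) * v T)"
      unfolding sum_subtractf[symmetric]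
    proof (intro sum.cong refl)
      fix T assume "T \<in> Pow N"
      then have "{i. i \<in> N \<and> i \<in> T} = T" "{i. i \<in> N \<and> i \<notin> T} = N - T" by auto
      then show "(\<Sum>i | i \<in> N \<and> i \<in> T. c (card T - 1) * v T) -
          (\<Sum>i | i \<in> N \<and> i \<notin> T. c (card T) * v T) =
          (real (card T) * c (card T - 1) - real (card (N - T)) * c (card T)) * v T"
        by (simp add: left_diff_distrib)
    qed
    also have "\<dots> = (\<Sum>T\<in>Pow N. (if T = N then v T else 0) - (if T = {} then v T else 0))"
    proof (intro sum.cong refl)
      fix T assume "T \<in> Pow N"
      then show "(real (card T) * c (card T - 1) - real (card (N - T)) * c (card T)) * v T =
          (if T = N then v T else 0) - (if T = {} then v T else 0)"
        using False by (subst coeff) auto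
    qed
    also have "\<dots> = v N"
      using assms by (simp add: sum_subtractf)
    finally show ?thesis .
  qed (simp add: assms)
qed

text \<open>The weights are the payoff of the only productive player in the unanimity game of that player.\<close>

lemma shapley_weights_sum:
  assumes "finite N" "i \<in> N"
  shows "(\<Sum>S\<in>Pow (N - {i}). fact (card S) * fact (card N - card S - 1) / fact (card N)) = (1::real)"
proof -
  define v :: "'a set \<Rightarrow> real" where "v S = (if i \<in> S then 1 else 0)" for S
  have "1 = (\<Sum>k\<in>N. shapley N v k)"
    using shapley_efficient[of N v] assms by (simp add: v_def)
  \<comment> \<open>Every player other than \<open>i\<close> is a null player of
    \<open>v\<close>.\<close>
  also have "\<dots> = (\<Sum>k\<in>N. if k = i then shapley N v i else 0)"
    by (intro sum.cong refl) (auto simp: shapley_def v_def)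
  also have "\<dots> = shapley N v i"
    using assms by simp
  also have "\<dots> = (\<Sum>S\<in>Pow (N - {i}). fact (card S) * fact (card N - card S - 1) / fact (card N))"
    using assms(2) unfolding shapley_def restrict_apply'[OF assms(2)]
    by (intro sum.cong refl) (auto simp: v_def)
  finally show ?thesis by simp
qed

text \<open>Both sides are sums over the coalitions \<open>S\<close> avoiding \<open>i\<close> and
  \<open>j\<close>, involving only \<open>v\<close> at \<open>S\<close>, \<open>S + i\<close>,
  \<open>S + j\<close> and \<open>S + i + j\<close>; the coefficients are compared for each
  \<open>S\<close>. For \<open>x = shapley N v j\<close> the correction vanishes, which is Sobolev
  consistency of the Shapley value; a general \<open>x\<close> is needed for uniqueness.\<close>

lemma shapley_sobolev_reduced:
  assumes "finite N" "i \<in> N" "j \<in> N" "i \<noteq> j"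
  shows "shapley (N - {j}) (\<lambda>S. real (card S) / (real (card N) - 1) * (v (S \<union> {j}) - x) +
      (1 - real (card S) / (real (card N) - 1)) * v S) i =
    shapley N v i + (shapley N v j - x) / (real (card N) - 1)"
proof -
  define M where "M = N - {i, j}"
  define m where "m = card M"
  have M: "finite M" "i \<notin> M" "j \<notin> M" "N - {i} = insert j M" "N - {j} = insert i M"
    "N - {j} - {i} = M"
    using assms by (auto simp: M_def)
  have N: "N = insert i (insert j M)" using assms by (auto simp: M_def)
  have n: "card N = m + 2" "card (N - {j}) = m + 1"
    using assms M by (auto simp: N m_def)
  define r where "r = real m + 1"
  have r: "r > 0" "real (card N) - 1 = r" by (simp_all add: r_def n)
  have mem: "i \<in> N - {j}" using assms by simp
  \<comment> \<open>Coalitions with and without the second player \<open>b\<close> are paired, and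
    the common factor \<open>s! (m - s)! / (m + 2)!\<close> is taken out of their weights. It is
    used for \<open>(a, b) = (i, j)\<close> and for \<open>(j, i)\<close>.\<close>
  have splitN: "shapley N v a = (\<Sum>S\<in>Pow M. fact (card S) * fact (m - card S) / fact (m + 2) *
      ((real m - real (card S) + 1) * (v (insert a S) - v S) +
       (real (card S) + 1) * (v (insert a (insert b S)) - v (insert b S))))"
    if ab: "a \<in> N" "N - {a} = insert b M" "b \<notin> M" for a b
    unfolding shapley_def restrict_apply'[OF ab(1)] ab(2) sum_Pow_insert[OF M(1) ab(3)]
  proof (intro sum.cong refl)
    fix S assume S: "S \<in> Pow M"
    then have fS: "finite S" and bS: "b \<notin> S" and le: "card S \<le> m"
      using M(1) ab(3) finite_subset card_mono by (auto simp: m_def)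
    obtain k where k: "m = card S + k" using le by (auto simp: le_iff_add)
    have "card (insert b S) = Suc (card S)" using fS bS by simp
    moreover have "card N - card S - 1 = Suc k" "card N - Suc (card S) - 1 = k" "m - card S = k"
      using k n by auto
    moreover have "real m - real (card S) + 1 = real k + 1" using k by simp
    ultimately show "fact (card S) * fact (card N - card S - 1) / fact (card N) * (v (S \<union> {a}) - v S) +
        fact (card (insert b S)) * fact (card N - card (insert b S) - 1) / fact (card N) *
          (v (insert b S \<union> {a}) - v (insert b S)) =
      fact (card S) * fact (m - card S) / fact (m + 2) *
      ((real m - real (card S) + 1) * (v (insert a S) - v S) +
       (real (card S) + 1) * (v (insert a (insert b S)) - v (insert b S)))"
      by (simp only: n(1)[symmetric] fact_Suc of_nat_Suc Un_insert_right Un_empty_right)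
        (simp add: divide_simps, simp add: algebra_simps insert_commute)
  qed
  let ?u = "\<lambda>S. real (card S) / r * (v (S \<union> {j}) - x) + (1 - real (card S) / r) * v S"
  let ?c = "\<lambda>S. fact (card S) * fact (m - card S) / fact (m + 1) :: real"
  have "shapley (N - {j}) ?u i = (\<Sum>S\<in>Pow M. ?c S * (?u (insert i S) - ?u S))"
    unfolding shapley_def restrict_apply'[OF mem] M(6) n by simp
  also have "\<dots> = (\<Sum>S\<in>Pow M. fact (card S) * fact (m - card S) / fact (m + 2) *
        ((real m - real (card S) + 1) * (v (insert i S) - v S) +
         (real (card S) + 1) * (v (insert i (insert j S)) - v (insert j S))) +
      fact (card S) * fact (m - card S) / fact (m + 2) *
        ((real m - real (card S) + 1) * (v (insert j S) - v S) +
         (real (card S) + 1) * (v (insert j (insert i S)) - v (insert i S))) / r -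
      ?c S * (x / r))"
  proof (intro sum.cong refl)
    fix S assume S: "S \<in> Pow M"
    then have fS: "finite S" and iS: "i \<notin> S"
      using M finite_subset by auto
    \<comment> \<open>Passing from the weights of \<open>m + 1\<close> players to the common factor
      for \<open>m + 2\<close> players costs \<open>m + 2 = r + 1\<close>.\<close>
    have c: "?c S = fact (card S) * fact (m - card S) / fact (m + 2) * (r + 1)"
    proof -
      have "fact (m + 2) = (r + 1) * (fact (m + 1) :: real)"
        by (simp add: r_def algebra_simps)
      then show ?thesis using r(1) by (simp del: fact_Suc add_2_eq_Suc')
    qed
    have s: "real (card (insert i S)) = real (card S) + 1"
      using fS iS by simp
    have m: "real m = r - 1" by (simp add: r_def)
    define q where "q = (fact (card S) * fact (m - card S) / fact (m + 2) :: real)"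
    have ij: "insert i S \<union> {j} = insert i (insert j S)" "insert j (insert i S) = insert i (insert j S)"
      by auto
    show "?c S * (?u (insert i S) - ?u S) = fact (card S) * fact (m - card S) / fact (m + 2) *
        ((real m - real (card S) + 1) * (v (insert i S) - v S) +
         (real (card S) + 1) * (v (insert i (insert j S)) - v (insert j S))) +
      fact (card S) * fact (m - card S) / fact (m + 2) *
        ((real m - real (card S) + 1) * (v (insert j S) - v S) +
         (real (card S) + 1) * (v (insert j (insert i S)) - v (insert i S))) / r -
      ?c S * (x / r)"
      unfolding c s m ij q_def[symmetric] using r(1)
      by (simp add: field_simps)
  qed
  also have "\<dots> = shapley N v i + shapley N v j / r - (\<Sum>S\<in>Pow M. ?c S) * (x / r)"
    unfolding sum_subtractf sum.distrib
      splitN[OF assms(2) M(4,3)] splitN[OF assms(3) M(5,2)]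
    by (simp add: sum_divide_distrib sum_distrib_right)
  \<comment> \<open>When \<open>i\<close> joins \<open>S\<close>, the share of \<open>x\<close> that
    is charged grows by \<open>1 / r\<close>, whatever \<open>S\<close> is; as the weights total
    one, \<open>i\<close> loses exactly \<open>x / r\<close>.\<close>
  also have "(\<Sum>S\<in>Pow M. ?c S) = 1"
    using shapley_weights_sum[OF _ mem] assms(1) by (simp add: n M(6))
  finally show ?thesis
    unfolding r(2) by (simp add: diff_divide_distrib)
qed

section \<open>Averaging over partitions\<close>

lemma finite_partitions: "finite N \<Longrightarrow> finite (partitions N)"
  by (simp add: partitions_def finitely_many_partition_on)

section \<open>Growing a partition by one player\<close>

lemma sum_block_of:
  assumes "finite M" "\<pi> \<in> partitions M"
  shows "(\<Sum>k\<in>M. g (block_of \<pi> k)) = (\<Sum>B\<in>\<pi>. real (card B) * g B)"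
proof -
  have \<pi>: "\<Union>\<pi> = M" "\<And>A B. A \<in> \<pi> \<Longrightarrow> B \<in> \<pi> \<Longrightarrow> A \<noteq> B \<Longrightarrow> A \<inter> B = {}"
    using assms(2) by (auto simp: partitions_def partition_on_def disjoint_def)
  have "(\<Sum>k\<in>\<Union>\<pi>. g (block_of \<pi> k)) = (\<Sum>B\<in>\<pi>. \<Sum>k\<in>B. g (block_of \<pi> k))"
    using assms(1) \<pi> finite_subset by (subst sum.Union_disjoint) (auto intro: finite_subset)
  also have "\<dots> = (\<Sum>B\<in>\<pi>. real (card B) * g B)"
    by (intro sum.cong refl) (simp add: block_of_eq[OF assms(2)])
  finally show ?thesis by (simp add: \<pi>)
qed

text \<open>A partition of \<open>insert j M\<close> is determined by what remains of it after
  deleting \<open>j\<close> and by the set of companions of \<open>j\<close>, which is a block of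
  the remainder, or \<open>{}\<close> if \<open>j\<close> was alone.\<close>

lemma sum_partitions_insert:
  assumes "finite M" "j \<notin> M"
  shows "(\<Sum>\<pi>\<in>partitions (insert j M). f \<pi>) =
    (\<Sum>\<pi>\<in>partitions M. \<Sum>B\<in>insert {} \<pi>. f (add_player \<pi> j B))"
proof -
  have fin: "finite \<pi>" if "\<pi> \<in> partitions M" for \<pi>
    using that assms(1) finite_elements by (auto simp: partitions_def)
  have "(\<Sum>\<pi>\<in>partitions M. \<Sum>B\<in>insert {} \<pi>. f (add_player \<pi> j B)) =
      (\<Sum>(\<pi>, B)\<in>(SIGMA \<pi>:partitions M. insert {} \<pi>). f (add_player \<pi> j B))"
    using assms(1) fin by (intro sum.Sigma) (auto simp: finite_partitions)
  also have "\<dots> = (\<Sum>\<pi>\<in>partitions (insert j M). f \<pi>)"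
  \<comment> \<open>The inverse strips \<open>j\<close> from its block. If nothing is left, the
    empty set is dropped from the partition but kept as the second component, where it encodes that
    \<open>j\<close> was alone.\<close>
  proof (rule sum.reindex_bij_witness[where
        j = "\<lambda>(\<pi>, B). add_player \<pi> j B" and
        i = "\<lambda>\<pi>. (\<pi> - {block_of \<pi> j} \<union> ({block_of \<pi> j - {j}} - {{}}), block_of \<pi> j - {j})"])
    fix a assume "a \<in> (SIGMA \<pi>:partitions M. insert {} \<pi>)"
    then obtain \<pi> B where a: "a = (\<pi>, B)" "\<pi> \<in> partitions M" "B \<in> insert {} \<pi>"
      by auto
    have in': "add_player \<pi> j B \<in> partitions (insert j M)"
      using add_player_partition a assms(2) by metis
    have jC: "j \<notin> C" "C \<noteq> {}" if "C \<in> \<pi>" for C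
      using that a assms(2) by (auto simp: partitions_def partition_on_def)
    have blk: "block_of (add_player \<pi> j B) j = insert j B"
      by (rule block_of_eq[OF in']) (auto simp: add_player_def)
    have "insert j B - {j} = B" using a jC by auto
    then show "(\<lambda>\<pi>. (\<pi> - {block_of \<pi> j} \<union> ({block_of \<pi> j - {j}} - {{}}), block_of \<pi> j - {j}))
        ((\<lambda>(\<pi>, B). add_player \<pi> j B) a) = a"
      using a jC unfolding a prod.case blk by (auto simp: add_player_def)
    show "(\<lambda>(\<pi>, B). add_player \<pi> j B) a \<in> partitions (insert j M)"
      using in' a by simp
  next
    fix \<pi> assume \<pi>: "\<pi> \<in> partitions (insert j M)"
    define C where "C = block_of \<pi> j"
    obtain C' where "C' \<in> \<pi>" "j \<in> C'" using \<pi> by (auto simp: partitions_def partition_on_def)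
    then have C: "C \<in> \<pi>" "j \<in> C" using block_of_eq[OF \<pi>] by (auto simp: C_def)
    have disj: "D \<inter> D' = {}" if "D \<in> \<pi>" "D' \<in> \<pi>" "D \<noteq> D'" for D D'
      using that \<pi> by (auto simp: partitions_def partition_on_def disjoint_def)
    have un: "\<Union>\<pi> = insert j M" using \<pi> by (auto simp: partitions_def partition_on_def)
    have D: "j \<notin> D" "D \<inter> C = {}" "D \<noteq> {}" "D \<subseteq> M" if "D \<in> \<pi>" "D \<noteq> C" for D
    proof -
      show "D \<inter> C = {}" using disj that C(1) by blast
      then show "j \<notin> D" using C(2) by blast
      then show "D \<subseteq> M" using un that(1) by auto
      show "D \<noteq> {}" using that(1) \<pi> by (auto simp: partitions_def partition_on_def)
    qed
    \<comment> \<open>Otherwise \<open>add_player\<close>, which replaces the block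
      \<open>C - {j}\<close> by \<open>C\<close>, would also delete an original block.\<close>
    have notin: "C - {j} \<notin> \<pi> - {C}"
    proof
      assume "C - {j} \<in> \<pi> - {C}"
      then show False using D[of "C - {j}"] by auto
    qed
    show "(\<lambda>(\<pi>, B). add_player \<pi> j B)
        (\<pi> - {block_of \<pi> j} \<union> ({block_of \<pi> j - {j}} - {{}}), block_of \<pi> j - {j}) = \<pi>"
    proof (cases "C - {j} = {}")
      case True
      then have "C = {j}" using C(2) by auto
      then show ?thesis
        unfolding C_def[symmetric] prod.case using C(1) by (auto simp: add_player_def)
    next
      case False
      then show ?thesis
        unfolding C_def[symmetric] prod.case
        using C notin by (simp add: add_player_def insert_absorb)
    qed
    have "partition_on M (\<pi> - {C} \<union> ({C - {j}} - {{}}))"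
    proof (rule partition_onI)
      show "\<Union>(\<pi> - {C} \<union> ({C - {j}} - {{}})) = M"
      proof (intro equalityI subsetI)
        fix x assume "x \<in> M"
        then show "x \<in> \<Union>(\<pi> - {C} \<union> ({C - {j}} - {{}}))"
          using un assms(2) by (cases "x \<in> C") auto
      next
        have "C - {j} \<subseteq> M" using un C(1) by auto
        then show "x \<in> M" if "x \<in> \<Union>(\<pi> - {C} \<union> ({C - {j}} - {{}}))" for x
          using that D(4) by blast
      qed
      show "disjnt p q" if "p \<in> \<pi> - {C} \<union> ({C - {j}} - {{}})"
        "q \<in> \<pi> - {C} \<union> ({C - {j}} - {{}})" "p \<noteq> q" for p q
        using that disj[of p q] D(2)[of p] D(2)[of q] unfolding disjnt_def by auto
    qed (use D(3) in auto)
    then show "(\<pi> - {block_of \<pi> j} \<union> ({block_of \<pi> j - {j}} - {{}}), block_of \<pi> j - {j})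
        \<in> (SIGMA \<pi>:partitions M. insert {} \<pi>)"
      unfolding C_def[symmetric] by (auto simp: partitions_def)
  qed auto
  finally show ?thesis ..
qed

text \<open>For a partition of a finite set, this is the number of permutations whose cycles, fixed
  points included, have exactly the blocks as their supports.\<close>

definition block_weight :: "'a set set \<Rightarrow> real"
  where "block_weight \<pi> = (\<Prod>B\<in>\<pi>. fact (card B - 1))"

text \<open>Enlarging a block of size \<open>b\<close> turns its factor \<open>(b - 1)!\<close> into
  \<open>b!\<close>, whereas a new singleton contributes \<open>0! = 1\<close>.\<close>

lemma block_weight_add_player:
  assumes "finite M" "j \<notin> M" "\<pi> \<in> partitions M" "B \<in> insert {} \<pi>"
  shows "block_weight (add_player \<pi> j B) = (if B = {} then 1 else real (card B)) * block_weight \<pi>"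
proof -
  have \<pi>: "finite \<pi>" "{} \<notin> \<pi>" "\<And>C. C \<in> \<pi> \<Longrightarrow> j \<notin> C" "\<And>C. C \<in> \<pi> \<Longrightarrow> finite C"
    using assms(1-3) finite_elements
    by (auto simp: partitions_def partition_on_def intro: finite_subset[of _ M])
  show ?thesis
  proof (cases "B = {}")
    case True
    have "{j} \<notin> \<pi>" using \<pi> by auto
    then show ?thesis using True \<pi> by (simp add: block_weight_def add_player_def)
  next
    case False
    then have B: "B \<in> \<pi>" using assms(4) by simp
    then have "card B > 0" using \<pi> False by (simp add: card_gt_0_iff)
    then obtain b where b: "card B = Suc b" by (cases "card B") auto
    \<comment> \<open>The product runs over a set, so the enlarged block must not coincide with a
      block already present.\<close>
    have "insert j B \<notin> \<pi>" using \<pi> by auto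
    then have "block_weight (add_player \<pi> j B) = fact (card B) * (\<Prod>C\<in>\<pi> - {B}. fact (card C - 1))"
      using \<pi> B False by (simp add: block_weight_def add_player_def)
    moreover have "block_weight \<pi> = fact (card B - 1) * (\<Prod>C\<in>\<pi> - {B}. fact (card C - 1))"
      using \<pi> B by (simp add: block_weight_def prod.remove)
    ultimately show ?thesis using False b by simp
  qed
qed

text \<open>Joining a block \<open>B\<close> multiplies the weight by its size, which is exactly the number of
  players \<open>k\<close> with \<open>\<pi>(k) = B\<close>.\<close>

lemma sum_block_weight_insert:
  assumes "finite M" "j \<notin> M"
  shows "(\<Sum>\<pi>\<in>partitions (insert j M). block_weight \<pi> * f \<pi>) =
    (\<Sum>\<pi>\<in>partitions M. block_weight \<pi> *
      (f (add_player \<pi> j {}) + (\<Sum>k\<in>M. f (add_player \<pi> j (block_of \<pi> k)))))"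
  unfolding sum_partitions_insert[OF assms]
proof (intro sum.cong refl)
  fix \<pi> assume \<pi>: "\<pi> \<in> partitions M"
  then have fin: "finite \<pi>" "{} \<notin> \<pi>"
    using assms(1) finite_elements by (auto simp: partitions_def partition_on_def)
  have "(\<Sum>B\<in>insert {} \<pi>. block_weight (add_player \<pi> j B) * f (add_player \<pi> j B)) =
    (\<Sum>B\<in>insert {} \<pi>. (if B = {} then 1 else real (card B)) * block_weight \<pi> * f (add_player \<pi> j B))"
    by (intro sum.cong refl) (simp only: block_weight_add_player[OF assms \<pi>])
  also have "\<dots> = block_weight \<pi> * f (add_player \<pi> j {}) +
      (\<Sum>B\<in>\<pi>. (if B = {} then 1 else real (card B)) * block_weight \<pi> * f (add_player \<pi> j B))"
    using fin by simp
  also have "(\<Sum>B\<in>\<pi>. (if B = {} then 1 else real (card B)) * block_weight \<pi> * f (add_player \<pi> j B)) =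
      (\<Sum>B\<in>\<pi>. block_weight \<pi> * (real (card B) * f (add_player \<pi> j B)))"
    using fin by (intro sum.cong refl) auto
  also have "block_weight \<pi> * f (add_player \<pi> j {}) + \<dots> = block_weight \<pi> *
      (f (add_player \<pi> j {}) + (\<Sum>k\<in>M. f (add_player \<pi> j (block_of \<pi> k))))"
    unfolding sum_block_of[OF assms(1) \<pi>, of "\<lambda>B. f (add_player \<pi> j B)"]
    by (simp add: sum_distrib_left distrib_left)
  finally show "(\<Sum>B\<in>insert {} \<pi>. block_weight (add_player \<pi> j B) * f (add_player \<pi> j B)) =
    block_weight \<pi> *
      (f (add_player \<pi> j {}) + (\<Sum>k\<in>M. f (add_player \<pi> j (block_of \<pi> k))))" .
qed

text \<open>This normalises the weights of \<open>average_game\<close> to total one. Each new player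
  has \<open>card M + 1\<close> options, counted with weight: staying alone, or following one of the
  members of \<open>M\<close>.\<close>

lemma sum_block_weight:
  assumes "finite M"
  shows "(\<Sum>\<pi>\<in>partitions M. block_weight \<pi>) = fact (card M)"
  using assms
proof (induction M)
  case empty
  show ?case by (simp add: partitions_empty block_weight_def)
next
  case (insert j M)
  then show ?case
    using sum_block_weight_insert[of M j "\<lambda>_. 1"]
    by (simp add: sum_distrib_right[symmetric] mult.commute add.commute)
qed

section \<open>Average games of reduced games\<close>

lemma average_game_eq:
  assumes "finite N" "S \<subseteq> N"
  shows "average_game N w S = (\<Sum>\<pi>\<in>partitions (N - S). block_weight \<pi> * w (S, \<pi>)) / fact (card (N - S))"
  using assms finite_subset[of S N]
  by (simp add: average_game_def block_weight_def sum_divide_distrib card_Diff_subset)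

text \<open>The options for \<open>j\<close> averaged in \<open>remove_player\<close> are those of
  the weighted recursion for partitions, and the factor \<open>1 / (n - s)\<close> is what changes
  \<open>(n - s - 1)!\<close> into \<open>(n - s)!\<close>.\<close>

lemma average_game_remove_player:
  assumes "finite N" "j \<in> N" "S \<subseteq> N - {j}"
  shows "average_game (N - {j}) (remove_player N w j) S = average_game N w S"
proof -
  define M where "M = N - {j} - S"
  have M: "finite M" "j \<notin> M" "N - S = insert j M" "N - (S \<union> {j}) = M"
    using assms by (auto simp: M_def)
  have SN: "S \<subseteq> N" "finite S" using assms finite_subset by auto
  have c: "card (insert j M) = Suc (card M)" using M by simp
  then have "card N - card S = Suc (card M)" using SN by (simp add: M(3)[symmetric] card_Diff_subset)
  then have cN: "real (card N) - real (card S) = real (card M) + 1" by simp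
  have "average_game N w S = (\<Sum>\<pi>\<in>partitions M. block_weight \<pi> *
      (w (S, add_player \<pi> j {}) + (\<Sum>k\<in>M. w (S, add_player \<pi> j (block_of \<pi> k))))) /
      fact (Suc (card M))"
    unfolding average_game_eq[OF assms(1) SN(1)] M(3) c
    by (simp add: sum_block_weight_insert[OF M(1,2), of "\<lambda>\<pi>. w (S, \<pi>)"])
  also have "\<dots> = (\<Sum>\<pi>\<in>partitions M. block_weight \<pi> * remove_player N w j (S, \<pi>)) / fact (card M)"
    unfolding sum_divide_distrib
  proof (intro sum.cong refl)
    fix \<pi> assume "\<pi> \<in> partitions M"
    then have "(S, \<pi>) \<in> embedded_coalitions (N - {j})"
      using assms(3) by (auto simp: embedded_coalitions_def M_def)
    then have "remove_player N w j (S, \<pi>) = (w (S, add_player \<pi> j {}) +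
        (\<Sum>k\<in>M. w (S, add_player \<pi> j (block_of \<pi> k)))) / (real (card M) + 1)"
      by (simp only: remove_player_def restrict_apply' prod.case cN M(4)) simp
    then show "block_weight \<pi> * (w (S, add_player \<pi> j {}) +
        (\<Sum>k\<in>M. w (S, add_player \<pi> j (block_of \<pi> k)))) / fact (Suc (card M)) =
      block_weight \<pi> * remove_player N w j (S, \<pi>) / fact (card M)"
      by (simp add: add.commute)
  qed
  also have "\<dots> = average_game (N - {j}) (remove_player N w j) S"
    using assms by (simp add: average_game_eq M_def)
  finally show ?thesis ..
qed

text \<open>Averaging is linear, and the constant \<open>\<phi> N w j\<close> passes through it
  because the weights total one.\<close>

lemma average_game_sobolev_reduced:
  assumes "finite N" "j \<in> N" "S \<subseteq> N - {j}"
  shows "average_game (N - {j}) (sobolev_reduced \<phi> N w j) S =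
    real (card S) / (real (card N) - 1) * (average_game N w (S \<union> {j}) - \<phi> N w j) +
    (1 - real (card S) / (real (card N) - 1)) * average_game N w S"
proof -
  define M where "M = N - {j} - S"
  define p where "p = real (card S) / (real (card N) - 1)"
  have M: "finite M" "N - (S \<union> {j}) = M"
    using assms by (auto simp: M_def)
  have "average_game (N - {j}) (sobolev_reduced \<phi> N w j) S =
      (\<Sum>\<pi>\<in>partitions M. block_weight \<pi> * sobolev_reduced \<phi> N w j (S, \<pi>)) / fact (card M)"
    using assms by (simp add: average_game_eq M_def)
  also have "(\<Sum>\<pi>\<in>partitions M. block_weight \<pi> * sobolev_reduced \<phi> N w j (S, \<pi>)) =
      (\<Sum>\<pi>\<in>partitions M. p * (block_weight \<pi> * w (S \<union> {j}, \<pi>)) - p * \<phi> N w j * block_weight \<pi> +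
        (1 - p) * (block_weight \<pi> * remove_player N w j (S, \<pi>)))"
  proof (intro sum.cong refl)
    fix \<pi> assume "\<pi> \<in> partitions M"
    then have "(S, \<pi>) \<in> embedded_coalitions (N - {j})"
      using assms(3) by (auto simp: embedded_coalitions_def M_def)
    then have reduced: "sobolev_reduced \<phi> N w j (S, \<pi>) =
        p * (w (S \<union> {j}, \<pi>) - \<phi> N w j) + (1 - p) * remove_player N w j (S, \<pi>)"
      by (simp add: sobolev_reduced_def p_def)
    show "block_weight \<pi> * sobolev_reduced \<phi> N w j (S, \<pi>) =
        p * (block_weight \<pi> * w (S \<union> {j}, \<pi>)) - p * \<phi> N w j * block_weight \<pi> +
        (1 - p) * (block_weight \<pi> * remove_player N w j (S, \<pi>))"
      unfolding reduced by (simp add: algebra_simps)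
  qed
  also have "\<dots> / fact (card M) =
      p * ((\<Sum>\<pi>\<in>partitions M. block_weight \<pi> * w (S \<union> {j}, \<pi>)) / fact (card M)) - p * \<phi> N w j +
      (1 - p) * ((\<Sum>\<pi>\<in>partitions M. block_weight \<pi> * remove_player N w j (S, \<pi>)) / fact (card M))"
    by (simp add: sum.distrib sum_subtractf sum_distrib_left[symmetric] sum_block_weight[OF M(1)]
        add_divide_distrib diff_divide_distrib)
  \<comment> \<open>The outsiders of \<open>S \<union> {j}\<close> in \<open>N\<close> are those of
    \<open>S\<close> in \<open>N - {j}\<close>, so the same partitions and weights occur.\<close>
  also have "(\<Sum>\<pi>\<in>partitions M. block_weight \<pi> * w (S \<union> {j}, \<pi>)) / fact (card M) =
      average_game N w (S \<union> {j})"
    using assms by (subst average_game_eq) (auto simp: M(2) simp del: Un_insert_right)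
  also have "(\<Sum>\<pi>\<in>partitions M. block_weight \<pi> * remove_player N w j (S, \<pi>)) / fact (card M) =
      average_game N w S"
    using assms average_game_remove_player[OF assms, of w] by (simp add: average_game_eq M_def)
  finally show ?thesis
    by (simp add: p_def right_diff_distrib)
qed

section \<open>The characterization\<close>

lemma MPW_eq: "N \<subseteq> U \<Longrightarrow> w \<in> tux_games N \<Longrightarrow> MPW U N w = shapley N (average_game N w)"
  by (simp add: MPW_def)

text \<open>The solution \<open>\<phi>\<close> that pays the leaving player is arbitrary:
  \<open>\<phi> = MPW U\<close> yields consistency of MPW, and a competing solution yields the
  recursion for its deviation from MPW.\<close>

lemma MPW_sobolev_reduced:
  assumes "finite U" "N \<subseteq> U" "w \<in> tux_games N" "i \<in> N" "j \<in> N" "i \<noteq> j"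
  shows "MPW U (N - {j}) (sobolev_reduced \<phi> N w j) i =
    MPW U N w i + (MPW U N w j - \<phi> N w j) / (real (card N) - 1)"
proof -
  have fin: "finite N" using assms finite_subset by blast
  have "MPW U (N - {j}) (sobolev_reduced \<phi> N w j) =
      shapley (N - {j}) (average_game (N - {j}) (sobolev_reduced \<phi> N w j))"
    using assms by (intro MPW_eq sobolev_reduced_tux_games) auto
  also have "\<dots> = shapley (N - {j}) (\<lambda>S. real (card S) / (real (card N) - 1) *
      (average_game N w (S \<union> {j}) - \<phi> N w j) +
      (1 - real (card S) / (real (card N) - 1)) * average_game N w S)"
    using fin assms(5) by (intro shapley_cong average_game_sobolev_reduced)
  finally show ?thesis
    using shapley_sobolev_reduced[OF fin assms(4-6), of "average_game N w" "\<phi> N w j"]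
    by (simp add: MPW_eq[OF assms(2,3)])
qed

section \<open>The three axioms for MPW\<close>

lemma MPW_efficient:
  assumes "finite U"
  shows "efficient U (MPW U)"
  unfolding efficient_def
proof (intro allI impI ballI)
  fix N and w :: "'a tux" assume N: "N \<subseteq> U" and w: "w \<in> tux_games N"
  have fin: "finite N" using assms N finite_subset by blast
  have "(\<Sum>i\<in>N. MPW U N w i) = average_game N w N"
    unfolding MPW_eq[OF N w]
    using average_game_tu_games[OF w] fin by (intro shapley_efficient) (auto simp: tu_games_def)
  \<comment> \<open>The grand coalition has no outsiders, hence only the empty partition, of weight
    one.\<close>
  also have "\<dots> = w (N, {})"
    by (simp add: average_game_def partitions_empty)
  finally show "(\<Sum>i\<in>N. MPW U N w i) = w (N, {})" .
qed

lemma partitions_singleton: "partitions {a} = {{{a}}}"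
proof (intro equalityI subsetI)
  fix \<pi> assume "\<pi> \<in> partitions {a}"
  then have \<pi>: "\<Union>\<pi> = {a}" "{} \<notin> \<pi>"
    by (auto simp: partitions_def partition_on_def)
  then have "B = {a}" if "B \<in> \<pi>" for B
    using that by (metis Union_upper subset_singletonD)
  then have "\<pi> \<subseteq> {{a}}" by blast
  moreover have "\<pi> \<noteq> {}" using \<pi>(1) by auto
  ultimately show "\<pi> \<in> {{{a}}}" by blast
qed (auto simp: partitions_def partition_on_def)

text \<open>A non-empty coalition of a two-player game has at most one outsider, hence faces a
  single partition; averaging changes nothing, and the two-player Shapley formula remains.\<close>

lemma MPW_two_standard: "two_standard U (MPW U)"
  unfolding two_standard_def
proof (intro allI impI ballI, elim conjE)
  fix i j and w :: "'a tux" assume ij: "{i, j} \<subseteq> U" "i \<noteq> j" and w: "w \<in> tux_games {i, j}"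
  have d: "{i, j} - {i} = {j}" "{i, j} - {j} = {i}" using ij by auto
  have "average_game {i, j} w {} = 0"
    using average_game_tu_games[OF w] by (simp add: tu_games_def)
  moreover have "average_game {i, j} w {i} = w ({i}, {{j}})"
    "average_game {i, j} w {j} = w ({j}, {{i}})"
    using ij by (simp_all add: average_game_def d partitions_singleton)
  moreover have "average_game {i, j} w {i, j} = w ({i, j}, {})"
    by (simp add: average_game_def partitions_empty)
  moreover have "Pow {j} = {{}, {j}}" by auto
  ultimately show "MPW U {i, j} w i =
      w ({i}, {{j}}) + (w ({i, j}, {}) - w ({j}, {{i}}) - w ({i}, {{j}})) / 2"
    using ij by (simp add: MPW_eq[OF ij(1) w] shapley_def d insert_commute field_simps)
qed

lemma MPW_sobolev_consistent:
  assumes "finite U"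
  shows "sobolev_consistent U (MPW U)"
  using MPW_sobolev_reduced[OF assms] by (simp add: sobolev_consistent_def)

section \<open>Uniqueness\<close>

text \<open>Induction on the number of players: efficiency settles one player, 2-standardness
  settles two, and consistency reduces larger games to smaller ones.\<close>

lemma MPW_unique:
  assumes "finite U" "efficient U \<phi>" "two_standard U \<phi>" "sobolev_consistent U \<phi>"
    and "N \<subseteq> U" "w \<in> tux_games N" "i \<in> N"
  shows "\<phi> N w i = MPW U N w i"
  using assms(5-)
proof (induction "card N" arbitrary: N w i rule: less_induct)
  case less
  have fin: "finite N" using less.prems(1) assms(1) finite_subset by blast
  consider "N = {i}" | j where "j \<noteq> i" "N = {i, j}" | j where "j \<in> N" "j \<noteq> i" "card N > 2"
  proof (cases "N = {i}")
    case False
    then obtain j where j: "j \<in> N" "j \<noteq> i" using less.prems(3) by blast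
    show thesis
    proof (cases "N = {i, j}")
      case True
      then show thesis using j that by blast
    next
      case False
      then have "{i, j} \<subset> N" using j less.prems(3) by blast
      then have "card {i, j} < card N" using fin by (rule psubset_card_mono[rotated])
      then show thesis using j that by auto
    qed
  qed
  then show ?case
  proof cases
    case 1
    have "(\<Sum>i\<in>N. \<phi> N w i) = (\<Sum>i\<in>N. MPW U N w i)"
      using assms(2) MPW_efficient[OF assms(1)] less.prems by (simp add: efficient_def)
    then show ?thesis using 1 by simp
  next
    case (2 j)
    then have ij: "{i, j} \<subseteq> U \<and> i \<noteq> j" "w \<in> tux_games {i, j}" using less.prems by auto
    show ?thesis
      unfolding 2(2) using assms(3) MPW_two_standard[of U] ij unfolding two_standard_def by metis
  next
    case (3 j)
    define d where "d k = \<phi> N w k - MPW U N w k" for k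
    define m where "m = real (card N) - 1"
    \<comment> \<open>Consistency moves \<open>\<phi>\<close> to the game reduced by its own payoff
      to \<open>l\<close>; there the induction hypothesis replaces \<open>\<phi>\<close> by
      MPW.\<close>
    have step: "d k = - d l / m" if kl: "k \<in> N" "l \<in> N" "k \<noteq> l" for k l
    proof -
      have "\<phi> N w k = \<phi> (N - {l}) (sobolev_reduced \<phi> N w l) k"
        using assms(4) less.prems kl by (simp add: sobolev_consistent_def)
      also have "\<dots> = MPW U (N - {l}) (sobolev_reduced \<phi> N w l) k"
        using fin kl less.prems
        by (intro less.hyps sobolev_reduced_tux_games) (auto intro!: psubset_card_mono simp del: card_Diff_singleton card_Diff_insert)
      also have "\<dots> = MPW U N w k + (MPW U N w l - \<phi> N w l) / m"
        unfolding m_def using assms(1) less.prems kl by (intro MPW_sobolev_reduced)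
      finally show ?thesis by (simp add: d_def minus_divide_left)
    qed
    \<comment> \<open>With two players \<open>m\<close> would be 1, and the relations
      \<open>d i = - d j\<close> and \<open>d j = - d i\<close> would not force \<open>d i\<close>
      to vanish. Here, going from \<open>i\<close> to \<open>j\<close> and back gives
      \<open>d i = d i / (m * m)\<close> with \<open>m * m > 1\<close>.\<close>
    have m: "m > 1" using 3 by (simp add: m_def)
    have di: "d i = - d j / m" using 3 less.prems by (intro step) auto
    have dj: "d j = - d i / m" using 3 less.prems by (intro step) auto
    have "d i = - (- d i / m) / m" by (fact di[unfolded dj])
    then have "d i * (m * m) = d i" using m by (simp add: eq_divide_eq)
    moreover have "m * m > 1" using m by (simp add: less_1_mult)
    ultimately have "d i = 0" by simp
    then show ?thesis by (simp add: d_def)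
  qed
qed

theorem theorem8:
  fixes U :: "'a set"
  assumes "finite U"
  shows "MPW U \<in> tux_solutions U \<and>
    efficient U (MPW U) \<and> two_standard U (MPW U) \<and> sobolev_consistent U (MPW U) \<and>
    (\<forall>\<phi>\<in>tux_solutions U.
      efficient U \<phi> \<and> two_standard U \<phi> \<and> sobolev_consistent U \<phi> \<longrightarrow> \<phi> = MPW U)"
proof (intro conjI ballI impI)
  fix \<phi> assume \<phi>: "\<phi> \<in> tux_solutions U"
    and ax: "efficient U \<phi> \<and> two_standard U \<phi> \<and> sobolev_consistent U \<phi>"
  show "\<phi> = MPW U"
  \<comment> \<open>Extensionality is applied at three levels, for player sets, games and players,
    so that \<open>MPW_unique\<close> is invoked only inside the domains.\<close>
  proof (rule PiE_ext[OF \<phi>[unfolded tux_solutions_def] MPW_tux_solutions[unfolded tux_solutions_def]])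
    fix N assume N: "N \<in> Pow U"
    have mem: "\<psi> N \<in> (\<Pi>\<^sub>E w\<in>tux_games N. extensional N)" if "\<psi> \<in> tux_solutions U" for \<psi>
      using that N unfolding tux_solutions_def by (rule PiE_mem)
    show "\<phi> N = MPW U N"
    proof (rule PiE_ext[OF mem[OF \<phi>] mem[OF MPW_tux_solutions]])
      fix w assume w: "w \<in> tux_games N"
      have "\<psi> N w \<in> extensional N" if "\<psi> \<in> tux_solutions U" for \<psi>
        using mem[OF that] w by (rule PiE_mem)
      then show "\<phi> N w = MPW U N w"
        using \<phi> MPW_tux_solutions N w ax assms
        by (intro extensionalityI[where A = N] MPW_unique) auto
    qed
  qed
qed (simp_all add: MPW_tux_solutions MPW_efficient MPW_two_standard MPW_sobolev_consistent assms)

end
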